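(* Let $P \in [0,1]^{n\times n}$ be a stochastic matrix with rational entries, let $r \in \mathbb{Z}^n$, and let $u \in \mathbb{R}^n$ be a bias vector of $(r,P)$, i.e. there is $\chi\in\mathbb{R}^n$ with $P\chi = \chi$ and $Pu = \chi + u - r$. Let $C_1,\dots,C_p$ be the recurrent classes of the Markov chain with transition matrix $P$ and $\pi^{(\ell)}$ the stationary distribution on $C_\ell$. Then: (i) if for every $\ell \in [p]$ there exists $i_\ell \in C_\ell$ with $u_{i_\ell}=0$, then $\|u\|_\infty \le 2\|r\|_\infty\, n \min\{D, M^{n-1}\}$; (ii) if $\sum_{i\in C_\ell} u_i \pi^{(\ell)}_i = 0$ for all $\ell\in[p]$, then $\|u\|_\infty \le 4\|r\|_\infty\, n\min\{D,M^{n-1}\}$.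
   Context: For each $i$, $M_i$ is the lowest common denominator of the entries of the $i$-th row of $P$; $M$ is the lowest common denominator of all entries of $P$; $D \coloneqq M_1\cdots M_n$. $\|\cdot\|_\infty$ is the supremum norm. *)

theory Defs
  imports "HOL-Analysis.Analysis"
begin

definition stochastic :: "real^'n^'n \<Rightarrow> bool" where
  "stochastic P \<longleftrightarrow> (\<forall>i j. P $ i $ j \<in> {0..1}) \<and> (\<forall>i. (\<Sum>j\<in>UNIV. P $ i $ j) = 1)"

definition lowest_common_denominator :: "real set \<Rightarrow> nat" where
  "lowest_common_denominator S = (LEAST m. 0 < m \<and> (\<forall>x\<in>S. real m * x \<in> \<int>))"

definition row_denominator :: "real^'n^'n \<Rightarrow> 'n \<Rightarrow> nat" where
  "row_denominator P i = lowest_common_denominator {P $ i $ j | j. True}"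

definition matrix_denominator :: "real^'n^'n \<Rightarrow> nat" where
  "matrix_denominator P = lowest_common_denominator {P $ i $ j | i j. True}"

definition bias_vector :: "real^'n \<Rightarrow> real^'n^'n \<Rightarrow> real^'n \<Rightarrow> bool" where
  "bias_vector r P u \<longleftrightarrow> (\<exists>g. P *v g = g \<and> P *v u = g + u - r)"

definition accessible :: "real^'n^'n \<Rightarrow> ('n \<times> 'n) set" where
  "accessible P = {(i, j). 0 < P $ i $ j}\<^sup>*"

definition communicating_class :: "real^'n^'n \<Rightarrow> 'n \<Rightarrow> 'n set" where
  "communicating_class P i = {j. (i, j) \<in> accessible P \<and> (j, i) \<in> accessible P}"

text \<open>\<open>first_passage P j k i\<close> is the probability that the chain started in \<open>i\<close> visits \<open>j\<close>
  at time \<open>k + 1\<close>, and at none of the times \<open>1, \<dots>, k\<close>.\<close>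

primrec first_passage :: "real^'n^'n \<Rightarrow> 'n \<Rightarrow> nat \<Rightarrow> 'n \<Rightarrow> real" where
  "first_passage P j 0 i = P $ i $ j"
| "first_passage P j (Suc k) i = (\<Sum>l\<in>UNIV - {j}. P $ i $ l * first_passage P j k l)"

definition recurrent_state :: "real^'n^'n \<Rightarrow> 'n \<Rightarrow> bool" where
  "recurrent_state P i \<longleftrightarrow> (\<lambda>k. first_passage P i k i) sums 1"

definition recurrent_classes :: "real^'n^'n \<Rightarrow> 'n set set" where
  "recurrent_classes P =
    {C. (\<exists>i. C = communicating_class P i) \<and> (\<forall>j\<in>C. recurrent_state P j)}"

text \<open>A distribution on the whole state space whose support lies in \<open>C\<close>; it is unique when
  \<open>C\<close> is a recurrent class.\<close>

definition stationary_distribution_on :: "real^'n^'n \<Rightarrow> 'n set \<Rightarrow> real^'n \<Rightarrow> bool" where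
  "stationary_distribution_on P C d \<longleftrightarrow>
    (\<forall>i. 0 \<le> d $ i) \<and> (\<forall>i. i \<notin> C \<longrightarrow> d $ i = 0) \<and> (\<Sum>i\<in>UNIV. d $ i) = 1 \<and> d v* P = d"

end

theory Submission
  imports Defs
begin

text \<open>For a set \<open>Z\<close> of states to which every state leads, let \<open>A\<close> be \<open>I - P\<close> with the rows in
  \<open>Z\<close> replaced by rows of the identity. By the maximum principle \<open>A\<close> has a nonnegative inverse \<open>G\<close>
  with \<open>1 \<le> G\<^sub>j\<^sub>j\<close> and \<open>G\<^sub>i\<^sub>j \<le> G\<^sub>j\<^sub>j\<close>. Cramer's rule says that adding \<open>j\<close> to \<open>Z\<close> multiplies \<open>det A\<close> by
  \<open>G\<^sub>j\<^sub>j\<close>, so \<open>0 < det A \<le> 1\<close> and \<open>G\<^sub>i\<^sub>j \<le> 1 / det A\<close>. Clearing denominators row by row shows that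
  \<open>det A\<close> is a positive integer divided by \<open>\<Prod>i\<notin>Z. M\<^sub>i\<close>; hence the expected hitting times \<open>y\<close> of \<open>Z\<close>
  are at most \<open>n min {D, M^(n-1)}\<close>. Since \<open>\<parallel>\<chi>\<parallel> \<le> \<parallel>r\<parallel>\<close>, the function \<open>u - 2\<parallel>r\<parallel> y\<close> is
  subharmonic off \<open>Z\<close>, and the maximum principle bounds \<open>u\<close> by \<open>2\<parallel>r\<parallel> y\<close> plus its values on \<open>Z\<close>.
  For (i) take for \<open>Z\<close> the zeros of \<open>u\<close>. For (ii) the same bound inside a closed class
  controls the oscillation of \<open>u\<close> there, hence its values, as its mean vanishes.\<close>

section \<open>Accessibility\<close>

definition closed_states :: "real^'n^'n \<Rightarrow> 'n set \<Rightarrow> bool" where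
  "closed_states P S \<longleftrightarrow> (\<forall>k\<in>S. \<forall>l. 0 < P $ k $ l \<longrightarrow> l \<in> S)"

definition leads_to :: "real^'n^'n \<Rightarrow> 'n set \<Rightarrow> 'n set \<Rightarrow> bool" where
  "leads_to P S Z \<longleftrightarrow> (\<forall>i\<in>S. \<exists>z\<in>Z. (i, z) \<in> accessible P)"

definition essential_state :: "real^'n^'n \<Rightarrow> 'n \<Rightarrow> bool" where
  "essential_state P j \<longleftrightarrow> (\<forall>k. (j, k) \<in> accessible P \<longrightarrow> (k, j) \<in> accessible P)"

lemma accessible_refl [simp]: "(i, i) \<in> accessible P"
  by (simp add: accessible_def)

lemma accessible_trans: "(i, j) \<in> accessible P \<Longrightarrow> (j, k) \<in> accessible P \<Longrightarrow> (i, k) \<in> accessible P"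
  unfolding accessible_def by (rule rtrancl_trans)

lemma accessible_step: "0 < P $ i $ j \<Longrightarrow> (i, j) \<in> accessible P"
  by (auto simp: accessible_def)

lemma closed_statesD: "closed_states P S \<Longrightarrow> k \<in> S \<Longrightarrow> 0 < P $ k $ l \<Longrightarrow> l \<in> S"
  unfolding closed_states_def by blast

lemma closed_states_UNIV [simp]: "closed_states P UNIV"
  by (simp add: closed_states_def)

lemma leads_to_mono: "leads_to P S Z \<Longrightarrow> Z \<subseteq> Z' \<Longrightarrow> leads_to P S Z'"
  unfolding leads_to_def by blast

lemma leads_to_Un_Compl: "leads_to P S Z \<Longrightarrow> leads_to P UNIV (Z \<union> - S)"
  unfolding leads_to_def using accessible_refl by blast

lemma leads_to_imp_nonempty: "leads_to P UNIV Z \<Longrightarrow> Z \<noteq> {}"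
  unfolding leads_to_def by blast

lemma communicating_class_self [simp]: "i \<in> communicating_class P i"
  by (simp add: communicating_class_def)

lemma communicating_class_leads_to:
  assumes "z \<in> communicating_class P j"
  shows "leads_to P (communicating_class P j) {z}"
  using assms accessible_trans[of _ j P z] by (simp add: leads_to_def communicating_class_def)

lemma closed_states_essential_class:
  assumes "essential_state P j"
  shows "closed_states P (communicating_class P j)"
  unfolding closed_states_def
proof (intro ballI allI impI)
  fix k l
  assume "k \<in> communicating_class P j" and "0 < P $ k $ l"
  then have "(j, l) \<in> accessible P"
    using accessible_trans[OF _ accessible_step] by (auto simp: communicating_class_def)
  then show "l \<in> communicating_class P j"
    using assms by (simp add: communicating_class_def essential_state_def)
qed

lemma essential_state_communicating_class:
  assumes "essential_state P j" "k \<in> communicating_class P j"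
  shows "essential_state P k"
  unfolding essential_state_def
proof (intro allI impI)
  fix l assume "(k, l) \<in> accessible P"
  moreover have j_to_k: "(j, k) \<in> accessible P"
    using assms(2) by (simp add: communicating_class_def)
  ultimately have "(l, j) \<in> accessible P"
    using assms(1) accessible_trans[OF j_to_k] by (simp add: essential_state_def)
  then show "(l, k) \<in> accessible P" using j_to_k by (rule accessible_trans)
qed

text \<open>A state accessible from \<open>i\<close> from which the fewest states are accessible is essential.\<close>

lemma leads_to_essential_states:
  fixes P :: "real^'n^'n"
  shows "leads_to P S {j. essential_state P j}"
proof -
  let ?R = "\<lambda>j. {k. (j, k) \<in> accessible P}"
  have "\<exists>j. (i, j) \<in> accessible P \<and> essential_state P j" for i
  proof -
    obtain j where j: "(i, j) \<in> accessible P"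
        and minimal: "\<And>k. (i, k) \<in> accessible P \<Longrightarrow> card (?R j) \<le> card (?R k)"
      using ex_has_least_nat[of "\<lambda>j. (i, j) \<in> accessible P" i "\<lambda>j. card (?R j)"] by auto
    have "(k, j) \<in> accessible P" if k: "(j, k) \<in> accessible P" for k
    proof -
      have "?R k \<subseteq> ?R j" using k accessible_trans by blast
      moreover have "card (?R j) \<le> card (?R k)" using minimal accessible_trans[OF j k] .
      ultimately have "?R k = ?R j" by (intro card_seteq) simp_all
      then show ?thesis by auto
    qed
    then show ?thesis using j unfolding essential_state_def by blast
  qed
  then show ?thesis unfolding leads_to_def by blast
qed

section \<open>Maximum principle\<close>

lemma stochastic_nonneg: "stochastic P \<Longrightarrow> 0 \<le> P $ i $ j"
  by (simp add: stochastic_def)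

lemma stochastic_row_sum: "stochastic P \<Longrightarrow> (\<Sum>j\<in>UNIV. P $ i $ j) = 1"
  by (simp add: stochastic_def)

lemma matrix_vector_mult_nth: "(A *v x) $ i = (\<Sum>j\<in>UNIV. A $ i $ j * x $ j)"
  by (simp add: matrix_vector_mult_def)

lemma stochastic_mean_diff:
  assumes "stochastic P"
  shows "m - (P *v x) $ k = (\<Sum>l\<in>UNIV. P $ k $ l * (m - x $ l))"
  by (simp add: right_diff_distrib sum_subtractf sum_distrib_right[symmetric]
      stochastic_row_sum[OF assms] matrix_vector_mult_nth)

lemma
  assumes stochastic: "stochastic P" and le_m: "\<And>l. 0 < P $ k $ l \<Longrightarrow> x $ l \<le> m"
  shows stochastic_mean_le_bound: "(P *v x) $ k \<le> m"
    and stochastic_mean_eq_bound: "m \<le> (P *v x) $ k \<Longrightarrow> 0 < P $ k $ l \<Longrightarrow> x $ l = m"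
proof -
  have nonneg: "0 \<le> P $ k $ j * (m - x $ j)" for j
    using le_m[of j] stochastic_nonneg[OF stochastic, of k j] by (cases "P $ k $ j = 0") auto
  then have "0 \<le> m - (P *v x) $ k"
    unfolding stochastic_mean_diff[OF stochastic] by (intro sum_nonneg)
  then show "(P *v x) $ k \<le> m" by simp
  assume "m \<le> (P *v x) $ k" and pos: "0 < P $ k $ l"
  with \<open>(P *v x) $ k \<le> m\<close> have "(\<Sum>j\<in>UNIV. P $ k $ j * (m - x $ j)) = 0"
    unfolding stochastic_mean_diff[OF stochastic, symmetric] by simp
  then have "P $ k $ l * (m - x $ l) = 0"
    using nonneg by (simp add: sum_nonneg_eq_0_iff)
  with pos show "x $ l = m" by simp
qed

lemma finite_attains_max:
  fixes f :: "'a \<Rightarrow> 'b::linorder"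
  assumes "finite S" "S \<noteq> {}"
  obtains m where "m \<in> S" "\<And>l. l \<in> S \<Longrightarrow> f l \<le> f m"
proof -
  obtain m where "m \<in> S" and max: "Max (f ` S) = f m" using obtains_MAX[OF assms] .
  moreover have "f l \<le> f m" if "l \<in> S" for l
    using Max_ge[of "f ` S" "f l"] assms(1) that by (simp add: max)
  ultimately show ?thesis using that by blast
qed

lemma maximum_principle:
  fixes P :: "real^'n^'n"
  assumes stochastic: "stochastic P" and closed: "closed_states P S" and leads: "leads_to P S Z"
    and subharmonic: "\<And>k. k \<in> S - Z \<Longrightarrow> x $ k \<le> (P *v x) $ k" and "i \<in> S"
  obtains z where "z \<in> S \<inter> Z" "x $ i \<le> x $ z"
proof -
  obtain m where m: "m \<in> S" "\<And>l. l \<in> S \<Longrightarrow> x $ l \<le> x $ m"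
    using finite_attains_max[of S "($) x"] \<open>i \<in> S\<close> by auto
  have propagate: "(k \<in> S \<and> x $ k = x $ m) \<or> (\<exists>z\<in>S \<inter> Z. x $ z = x $ m)"
    if "(m, k) \<in> accessible P" for k
    using that unfolding accessible_def
  proof (induction rule: rtrancl_induct)
    case base
    then show ?case using m(1) by simp
  next
    case (step k l)
    show ?case
    proof (cases "k \<in> S - Z \<and> x $ k = x $ m")
      case True
      then have "x $ l = x $ m"
        using stochastic_mean_eq_bound[OF stochastic, of k x "x $ m" l] step(2)
          closed_statesD[OF closed, of k] m(2) subharmonic[of k] by auto
      then show ?thesis using True step(2) closed_statesD[OF closed, of k l] by auto
    qed (use step.IH in auto)
  qed
  obtain z where "z \<in> Z" "(m, z) \<in> accessible P"
    using leads m(1) unfolding leads_to_def by blast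
  then obtain z where "z \<in> S \<inter> Z" "x $ z = x $ m" using propagate by blast
  then show ?thesis using that m(2)[OF \<open>i \<in> S\<close>] by simp
qed

section \<open>Essential states are recurrent\<close>

text \<open>Visits at time \<open>0\<close> do not count, so the value at \<open>i = j\<close> is the return probability.\<close>

definition hitting_probability :: "real^'n^'n \<Rightarrow> 'n \<Rightarrow> 'n \<Rightarrow> real" where
  "hitting_probability P j i = (\<Sum>k. first_passage P j k i)"

lemma first_passage_nonneg: "stochastic P \<Longrightarrow> 0 \<le> first_passage P j k i"
  by (induction k arbitrary: i) (auto intro!: sum_nonneg mult_nonneg_nonneg stochastic_nonneg)

lemma first_passage_partial_sum_Suc:
  "(\<Sum>k<Suc K. first_passage P j k i) =
    P $ i $ j + (\<Sum>l\<in>UNIV - {j}. P $ i $ l * (\<Sum>k<K. first_passage P j k l))"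
proof -
  have "(\<Sum>k<K. \<Sum>l\<in>UNIV - {j}. P $ i $ l * first_passage P j k l)
      = (\<Sum>l\<in>UNIV - {j}. P $ i $ l * (\<Sum>k<K. first_passage P j k l))"
    by (subst sum.swap) (simp add: sum_distrib_left)
  then show ?thesis by (simp add: sum.lessThan_Suc_shift del: sum.lessThan_Suc)
qed

lemma stochastic_row_split:
  "stochastic P \<Longrightarrow> P $ i $ j + (\<Sum>l\<in>UNIV - {j}. P $ i $ l) = 1"
  using stochastic_row_sum[of P i] by (simp add: sum.remove[of UNIV j])

lemma first_passage_partial_sum_le_1:
  assumes "stochastic P"
  shows "(\<Sum>k<K. first_passage P j k i) \<le> 1"
proof (induction K arbitrary: i)
  case (Suc K)
  have "(\<Sum>l\<in>UNIV - {j}. P $ i $ l * (\<Sum>k<K. first_passage P j k l))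
      \<le> (\<Sum>l\<in>UNIV - {j}. P $ i $ l)"
    using Suc stochastic_nonneg[OF assms] by (intro sum_mono) (simp add: mult_left_le)
  then show ?case
    unfolding first_passage_partial_sum_Suc
    using stochastic_row_split[OF assms, of i j] by linarith
qed simp

lemma first_passage_sums:
  assumes "stochastic P"
  shows "(\<lambda>k. first_passage P j k i) sums hitting_probability P j i"
  unfolding hitting_probability_def
  by (rule summable_sums[OF summableI_nonneg_bounded[OF first_passage_nonneg[OF assms]
        first_passage_partial_sum_le_1[OF assms]]])

lemma hitting_probability_le_1:
  assumes "stochastic P"
  shows "hitting_probability P j i \<le> 1"
proof (rule LIMSEQ_le_const2)
  show "(\<lambda>K. \<Sum>k<K. first_passage P j k i) \<longlonglongrightarrow> hitting_probability P j i"
    using first_passage_sums[OF assms] unfolding sums_def .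
  show "\<exists>N. \<forall>K\<ge>N. (\<Sum>k<K. first_passage P j k i) \<le> 1"
    using first_passage_partial_sum_le_1[OF assms] by blast
qed

lemma hitting_probability_first_step:
  assumes "stochastic P"
  shows "hitting_probability P j i =
    P $ i $ j + (\<Sum>l\<in>UNIV - {j}. P $ i $ l * hitting_probability P j l)"
proof (rule LIMSEQ_unique)
  have lim: "(\<lambda>K. \<Sum>k<K. first_passage P j k l) \<longlonglongrightarrow> hitting_probability P j l" for l
    using first_passage_sums[OF assms] unfolding sums_def .
  show "(\<lambda>K. \<Sum>k<Suc K. first_passage P j k i) \<longlonglongrightarrow> hitting_probability P j i"
    using lim by (rule LIMSEQ_Suc)
  show "(\<lambda>K. \<Sum>k<Suc K. first_passage P j k i)
      \<longlonglongrightarrow> P $ i $ j + (\<Sum>l\<in>UNIV - {j}. P $ i $ l * hitting_probability P j l)"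
    unfolding first_passage_partial_sum_Suc by (intro tendsto_intros lim)
qed

text \<open>The probability of never hitting \<open>j\<close>, set to \<open>0\<close> at \<open>j\<close> itself, is harmonic away from \<open>j\<close>.\<close>

lemma hitting_probability_eq_1:
  fixes P :: "real^'n^'n"
  assumes stochastic: "stochastic P" and closed: "closed_states P S" and leads: "leads_to P S {j}"
    and "i \<in> S"
  shows "hitting_probability P j i = 1"
proof (rule antisym)
  define h :: "real^'n" where "h = (\<chi> l. if l = j then 0 else 1 - hitting_probability P j l)"
  have mean_h: "(P *v h) $ k = 1 - hitting_probability P j k" for k
  proof -
    have "(P *v h) $ k = (\<Sum>l\<in>UNIV - {j}. P $ k $ l * (1 - hitting_probability P j l))"
      unfolding matrix_vector_mult_nth
      by (intro sum.mono_neutral_cong_right) (auto simp: h_def)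
    also have "\<dots> = (\<Sum>l\<in>UNIV - {j}. P $ k $ l)
        - (\<Sum>l\<in>UNIV - {j}. P $ k $ l * hitting_probability P j l)"
      by (simp add: right_diff_distrib sum_subtractf)
    finally show ?thesis
      using hitting_probability_first_step[OF stochastic, of j k]
        stochastic_row_split[OF stochastic, of k j] by linarith
  qed
  have "h $ l \<le> 0" if l: "l \<in> S" for l
  proof -
    have "h $ k \<le> (P *v h) $ k" if "k \<in> S - {j}" for k
      using that unfolding mean_h by (simp add: h_def)
    then obtain z where "z \<in> S \<inter> {j}" "h $ l \<le> h $ z"
      using maximum_principle[OF stochastic closed leads _ l] by blast
    then show ?thesis by (simp add: h_def)
  qed
  then have "(P *v h) $ i \<le> 0"
    using stochastic_mean_le_bound[OF stochastic] closed_statesD[OF closed \<open>i \<in> S\<close>] by blast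
  then show "1 \<le> hitting_probability P j i" by (simp add: mean_h)
qed (rule hitting_probability_le_1[OF stochastic])

lemma essential_state_recurrent:
  assumes "stochastic P" "essential_state P j"
  shows "recurrent_state P j"
proof -
  have "hitting_probability P j j = 1"
    by (rule hitting_probability_eq_1[OF assms(1) closed_states_essential_class[OF assms(2)]
          communicating_class_leads_to]) simp_all
  then show ?thesis
    using first_passage_sums[OF assms(1), of j j] by (simp add: recurrent_state_def)
qed

lemma essential_class_recurrent:
  assumes "stochastic P" "essential_state P j"
  shows "communicating_class P j \<in> recurrent_classes P"
  using essential_state_recurrent[OF assms(1) essential_state_communicating_class[OF assms(2)]]
  unfolding recurrent_classes_def by blast

lemma leads_to_if_meets_recurrent_classes:
  assumes stochastic: "stochastic P"
    and meets: "\<And>C. C \<in> recurrent_classes P \<Longrightarrow> C \<inter> Z \<noteq> {}"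
  shows "leads_to P S Z"
  unfolding leads_to_def
proof
  fix i assume "i \<in> S"
  then obtain j where j: "essential_state P j" "(i, j) \<in> accessible P"
    using leads_to_essential_states[of P S] unfolding leads_to_def by blast
  then obtain z where z: "z \<in> communicating_class P j" "z \<in> Z"
    using meets[OF essential_class_recurrent[OF stochastic]] by blast
  then have "(i, z) \<in> accessible P"
    using accessible_trans[OF j(2)] by (simp add: communicating_class_def)
  then show "\<exists>z\<in>Z. (i, z) \<in> accessible P" using z(2) by blast
qed

section \<open>Laplacian with absorbing states\<close>

definition killed_laplacian :: "real^'n^'n \<Rightarrow> 'n set \<Rightarrow> real^'n^'n" where
  "killed_laplacian P Z = (\<chi> i. if i \<in> Z then axis i 1 else axis i 1 - P $ i)"

definition green_matrix :: "real^'n^'n \<Rightarrow> 'n set \<Rightarrow> real^'n^'n" where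
  "green_matrix P Z = matrix_inv (killed_laplacian P Z)"

lemma killed_laplacian_mult:
  "(killed_laplacian P Z *v x) $ i = (if i \<in> Z then x $ i else x $ i - (P *v x) $ i)"
  by (simp add: killed_laplacian_def matrix_vector_mult_nth axis_def left_diff_distrib
      sum_subtractf if_distrib[where f="\<lambda>a. a * _"] cong: if_cong)

lemma killed_laplacian_nonneg:
  assumes stochastic: "stochastic P" and leads: "leads_to P UNIV Z"
    and nonneg: "\<And>i. 0 \<le> (killed_laplacian P Z *v x) $ i"
  shows "0 \<le> x $ i"
proof -
  have "(- x) $ k \<le> (P *v (- x)) $ k" if "k \<notin> Z" for k
    using nonneg[of k] that by (simp add: killed_laplacian_mult vec.neg)
  then obtain z where "z \<in> Z" "(- x) $ i \<le> (- x) $ z"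
    using maximum_principle[OF stochastic closed_states_UNIV leads, of "- x" i] by auto
  then show ?thesis using nonneg[of z] by (simp add: killed_laplacian_mult)
qed

lemma invertible_killed_laplacian:
  assumes "stochastic P" "leads_to P UNIV Z"
  shows "invertible (killed_laplacian P Z)"
  unfolding invertible_left_inverse matrix_left_invertible_ker
proof (intro allI impI)
  fix x assume kernel: "killed_laplacian P Z *v x = 0"
  have "0 \<le> x $ i" for i
    by (rule killed_laplacian_nonneg[OF assms]) (simp add: kernel)
  moreover have "0 \<le> (- x) $ i" for i
    by (rule killed_laplacian_nonneg[OF assms]) (simp add: kernel vec.neg)
  ultimately show "x = 0" by (simp add: vec_eq_iff order_antisym)
qed

lemma
  assumes "invertible A"
  shows matrix_inv_right: "A ** matrix_inv A = mat 1"
    and matrix_inv_left: "matrix_inv A ** A = mat 1"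
  unfolding matrix_inv_def
  by (rule someI2_ex[OF assms[unfolded invertible_def]], erule conjunct1 conjunct2)+

lemma killed_laplacian_mult_green_matrix:
  assumes "stochastic P" "leads_to P UNIV Z"
  shows "killed_laplacian P Z *v (green_matrix P Z *v x) = x"
  by (simp add: green_matrix_def matrix_vector_mul_assoc
      matrix_inv_right[OF invertible_killed_laplacian[OF assms]])

lemma killed_laplacian_mult_green_matrix_column:
  assumes "stochastic P" "leads_to P UNIV Z"
  shows "killed_laplacian P Z *v column j (green_matrix P Z) = axis j 1"
  using killed_laplacian_mult_green_matrix[OF assms, of "axis j 1"]
  by (simp add: matrix_vector_mult_basis)

lemma green_matrix_column:
  assumes "stochastic P" "leads_to P UNIV Z"
  shows "(if i \<in> Z then green_matrix P Z $ i $ j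
      else green_matrix P Z $ i $ j - (P *v column j (green_matrix P Z)) $ i) = axis j 1 $ i"
  using killed_laplacian_mult[of P Z "column j (green_matrix P Z)" i]
  unfolding killed_laplacian_mult_green_matrix_column[OF assms] by (simp add: column_def)

lemma green_matrix_nonneg:
  assumes "stochastic P" "leads_to P UNIV Z"
  shows "0 \<le> green_matrix P Z $ i $ j"
proof -
  have "0 \<le> (killed_laplacian P Z *v column j (green_matrix P Z)) $ k" for k
    by (simp add: killed_laplacian_mult_green_matrix_column[OF assms] axis_def)
  then have "0 \<le> column j (green_matrix P Z) $ i" by (rule killed_laplacian_nonneg[OF assms])
  then show ?thesis by (simp add: column_def)
qed

lemma green_matrix_diag_ge_1:
  assumes "stochastic P" "leads_to P UNIV Z"
  shows "1 \<le> green_matrix P Z $ j $ j"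
proof -
  have "0 \<le> (P *v column j (green_matrix P Z)) $ j"
    unfolding matrix_vector_mult_nth
    by (simp add: column_def sum_nonneg stochastic_nonneg green_matrix_nonneg assms)
  then show ?thesis
    using green_matrix_column[OF assms, of j j] by (simp split: if_splits)
qed

lemma green_matrix_le_diag:
  assumes stochastic: "stochastic P" and leads: "leads_to P UNIV Z"
  shows "green_matrix P Z $ i $ j \<le> green_matrix P Z $ j $ j"
proof -
  let ?g = "column j (green_matrix P Z)"
  have g: "?g $ k = green_matrix P Z $ k $ j" for k by (simp add: column_def)
  note g_eq = green_matrix_column[OF stochastic leads, of _ j, folded g]
  have "?g $ k \<le> (P *v ?g) $ k" if "k \<notin> insert j Z" for k
    using g_eq[of k] that by (simp add: axis_def)
  moreover have "leads_to P UNIV (insert j Z)" using leads by (rule leads_to_mono) auto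
  ultimately obtain z where z: "z \<in> insert j Z" "?g $ i \<le> ?g $ z"
    using maximum_principle[OF stochastic closed_states_UNIV, of "insert j Z" ?g i] by auto
  have "?g $ z \<le> ?g $ j"
  proof (cases "z = j")
    case False
    then have "?g $ z = 0" using g_eq[of z] z(1) by (simp add: axis_def)
    then show ?thesis using green_matrix_nonneg[OF stochastic leads] by (simp add: g)
  qed simp
  then show ?thesis using z(2) by (simp add: g)
qed

lemma det_killed_laplacian_insert:
  assumes "stochastic P" "leads_to P UNIV Z"
  shows "det (killed_laplacian P (insert j Z))
    = green_matrix P Z $ j $ j * det (killed_laplacian P Z)"
proof -
  let ?A = "killed_laplacian P Z" and ?G = "green_matrix P Z"
  have "(\<Sum>i\<in>UNIV. ?G $ j $ i *s row i ?A) = row j (?G ** ?A)"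
    by (simp add: vec_eq_iff row_def matrix_matrix_mult_def sum_component)
  also have "?G ** ?A = mat 1"
    unfolding green_matrix_def by (rule matrix_inv_left[OF invertible_killed_laplacian[OF assms]])
  also have "row j (mat 1) = axis j (1::real)"
    by (simp add: vec_eq_iff row_def mat_def axis_def)
  finally have "(\<Sum>i\<in>UNIV. ?G $ j $ i *s row i ?A) = axis j 1" .
  then have "(\<chi> i. if i = j then \<Sum>i\<in>UNIV. ?G $ j $ i *s row i ?A else row i ?A)
      = killed_laplacian P (insert j Z)"
    by (simp add: vec_eq_iff killed_laplacian_def row_def)
  then show ?thesis using cramer_lemma_transpose[of j "?G $ j" ?A] by simp
qed

lemma
  assumes stochastic: "stochastic P" and leads: "leads_to P UNIV Z"
  shows det_killed_laplacian_pos: "0 < det (killed_laplacian P Z)"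
    and det_killed_laplacian_le_1: "det (killed_laplacian P Z) \<le> 1"
proof -
  have "0 < det (killed_laplacian P Z) \<and> det (killed_laplacian P Z) \<le> 1"
    using finite[of "- Z"] leads
  proof (induction "- Z" arbitrary: Z rule: finite_induct)
    case empty
    then have "Z = UNIV" by blast
    then have "killed_laplacian P Z = mat 1"
      by (simp add: killed_laplacian_def vec_eq_iff mat_def axis_def)
    then show ?case by simp
  next
    case (insert j F)
    let ?d = "det (killed_laplacian P Z)" and ?d' = "det (killed_laplacian P (insert j Z))"
    have "F = - insert j Z" using insert.hyps by blast
    moreover have "leads_to P UNIV (insert j Z)" using insert.prems by (rule leads_to_mono) auto
    ultimately have IH: "0 < ?d' \<and> ?d' \<le> 1" by (rule insert.hyps(3))
    have cramer: "?d' = green_matrix P Z $ j $ j * ?d"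
      by (rule det_killed_laplacian_insert[OF stochastic insert.prems])
    have diag: "1 \<le> green_matrix P Z $ j $ j"
      by (rule green_matrix_diag_ge_1[OF stochastic insert.prems])
    have pos: "0 < ?d"
      using IH diag unfolding cramer by (simp add: zero_less_mult_iff)
    then have "?d \<le> ?d'" using diag by (simp add: cramer)
    then show ?case using pos IH by simp
  qed
  then show "0 < det (killed_laplacian P Z)" "det (killed_laplacian P Z) \<le> 1" by simp_all
qed

lemma green_matrix_le_inverse_det:
  assumes stochastic: "stochastic P" and leads: "leads_to P UNIV Z"
  shows "green_matrix P Z $ i $ j \<le> 1 / det (killed_laplacian P Z)"
proof -
  have "leads_to P UNIV (insert j Z)" using leads by (rule leads_to_mono) auto
  then have "green_matrix P Z $ j $ j * det (killed_laplacian P Z) \<le> 1"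
    using det_killed_laplacian_le_1[OF stochastic]
    by (simp flip: det_killed_laplacian_insert[OF assms])
  then have "green_matrix P Z $ j $ j \<le> 1 / det (killed_laplacian P Z)"
    using det_killed_laplacian_pos[OF assms] by (simp add: le_divide_eq)
  then show ?thesis using green_matrix_le_diag[OF assms] by (rule order_trans[rotated])
qed

section \<open>Denominators\<close>

lemma common_denominator_exists:
  fixes S :: "real set"
  assumes "finite S" "S \<subseteq> \<rat>"
  shows "\<exists>m::nat. 0 < m \<and> (\<forall>x\<in>S. real m * x \<in> \<int>)"
  using assms
proof (induction S rule: finite_induct)
  case (insert x S)
  then obtain m :: nat where m: "0 < m" "\<forall>x\<in>S. real m * x \<in> \<int>" by auto
  obtain a b where x_eq: "x = real_of_int a / real b" "b \<noteq> (0::nat)"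
    using insert.prems unfolding Rats_eq_int_div_nat by auto
  have "real (m * b) * x \<in> \<int>" using x_eq by simp
  moreover have "real (m * b) * y \<in> \<int>" if "y \<in> S" for y
    using Ints_mult[of "real b" "real m * y"] m(2) that by (simp add: mult_ac)
  ultimately show ?case
    using m(1) x_eq(2) by (intro exI[of _ "m * b"]) auto
qed auto

lemma lowest_common_denominator:
  fixes S :: "real set"
  assumes "finite S" "S \<subseteq> \<rat>"
  shows lowest_common_denominator_pos: "0 < lowest_common_denominator S"
    and lowest_common_denominator_mult: "x \<in> S \<Longrightarrow> real (lowest_common_denominator S) * x \<in> \<int>"
  using LeastI_ex[OF common_denominator_exists[OF assms]]
  unfolding lowest_common_denominator_def by blast+

lemma lowest_common_denominator_mono:
  fixes S T :: "real set"
  assumes "finite T" "T \<subseteq> \<rat>" "S \<subseteq> T"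
  shows "lowest_common_denominator S \<le> lowest_common_denominator T"
  unfolding lowest_common_denominator_def[of S]
  by (rule Least_le) (use lowest_common_denominator[OF assms(1,2)] assms(3) in blast)

lemma finite_matrix_entries: "finite {A $ i $ j | i j. True}"
  for A :: "'a^'n^'m"
  by (rule finite_subset[of _ "(\<lambda>(i, j). A $ i $ j) ` UNIV"]) auto

lemma finite_row_entries: "finite {A $ i $ j | j. True}"
  for A :: "'a^'n^'m"
  by (simp add: full_SetCompr_eq)

lemma row_denominator_pos:
  assumes "\<And>j. P $ i $ j \<in> \<rat>"
  shows "0 < row_denominator P i"
  unfolding row_denominator_def
  using assms by (intro lowest_common_denominator_pos finite_row_entries) auto

lemma row_denominator_mult:
  assumes "\<And>j. P $ i $ j \<in> \<rat>"
  shows "real (row_denominator P i) * P $ i $ j \<in> \<int>"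
  unfolding row_denominator_def
  using assms by (intro lowest_common_denominator_mult finite_row_entries) auto

lemma matrix_denominator_pos:
  assumes "\<And>i j. P $ i $ j \<in> \<rat>"
  shows "0 < matrix_denominator P"
  unfolding matrix_denominator_def
  using assms by (intro lowest_common_denominator_pos finite_matrix_entries) auto

lemma row_denominator_le_matrix_denominator:
  assumes "\<And>i j. P $ i $ j \<in> \<rat>"
  shows "row_denominator P i \<le> matrix_denominator P"
  unfolding row_denominator_def matrix_denominator_def
  using assms by (intro lowest_common_denominator_mono finite_matrix_entries) auto

definition denominator_bound :: "real^'n^'n \<Rightarrow> nat" where
  "denominator_bound P =
    min (\<Prod>i\<in>UNIV. row_denominator P i) (matrix_denominator P ^ (CARD('n) - 1))"

lemma prod_row_denominator_le_denominator_bound: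
  fixes P :: "real^'n^'n"
  assumes rational: "\<And>i j. P $ i $ j \<in> \<rat>" and "Z \<noteq> {}"
  shows "(\<Prod>i\<in>-Z. row_denominator P i) \<le> denominator_bound P"
  unfolding denominator_bound_def
proof (rule min.boundedI)
  show "(\<Prod>i\<in>-Z. row_denominator P i) \<le> (\<Prod>i\<in>UNIV. row_denominator P i)"
    by (intro dvd_imp_le prod_dvd_prod_subset prod_pos)
      (simp_all add: row_denominator_pos[OF rational])
  have "(\<Prod>i\<in>-Z. row_denominator P i) \<le> (\<Prod>i\<in>-Z. matrix_denominator P)"
    using row_denominator_le_matrix_denominator[OF rational] by (intro prod_mono) auto
  also have "\<dots> = matrix_denominator P ^ card (- Z)" by simp
  also have "\<dots> \<le> matrix_denominator P ^ (CARD('n) - 1)"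
  proof (rule power_increasing)
    have "card (- Z) < CARD('n)" using \<open>Z \<noteq> {}\<close> by (intro psubset_card_mono) auto
    then show "card (- Z) \<le> CARD('n) - 1" by simp
    show "1 \<le> matrix_denominator P"
      using matrix_denominator_pos[OF rational] by simp
  qed
  finally show "(\<Prod>i\<in>-Z. row_denominator P i) \<le> matrix_denominator P ^ (CARD('n) - 1)" .
qed

lemma det_Ints:
  fixes A :: "'a::comm_ring_1^'n^'n"
  assumes "\<And>i j. A $ i $ j \<in> \<int>"
  shows "det A \<in> \<int>"
  unfolding det_def using assms by (intro Ints_sum Ints_mult Ints_prod) auto

lemma prod_row_multipliers_det_Ints:
  fixes A :: "'a::comm_ring_1^'n^'n"
  assumes "\<And>i j. c i * A $ i $ j \<in> \<int>"
  shows "(\<Prod>i\<in>UNIV. c i) * det A \<in> \<int>"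
proof -
  have "det (\<chi> i. c i *s A $ i) \<in> \<int>" using assms by (intro det_Ints) simp
  then show ?thesis by (simp add: det_rows_mul)
qed

lemma inverse_det_killed_laplacian_le:
  fixes P :: "real^'n^'n"
  assumes stochastic: "stochastic P" and leads: "leads_to P UNIV Z"
    and rational: "\<And>i j. P $ i $ j \<in> \<rat>"
  shows "1 / det (killed_laplacian P Z) \<le> real (\<Prod>i\<in>-Z. row_denominator P i)"
proof -
  let ?c = "\<lambda>i. if i \<in> Z then 1 else real (row_denominator P i)"
  let ?D = "real (\<Prod>i\<in>-Z. row_denominator P i)"
  have "?c i * killed_laplacian P Z $ i $ j \<in> \<int>" for i j
    using row_denominator_mult[OF rational]
    by (auto simp: killed_laplacian_def axis_def right_diff_distrib)
  then have "(\<Prod>i\<in>UNIV. ?c i) * det (killed_laplacian P Z) \<in> \<int>"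
    by (rule prod_row_multipliers_det_Ints)
  also have "(\<Prod>i\<in>UNIV. ?c i) = ?D"
    unfolding of_nat_prod by (intro prod.mono_neutral_cong_right) auto
  finally have "?D * det (killed_laplacian P Z) \<in> \<int>" .
  moreover have "0 < ?D * det (killed_laplacian P Z)"
    using row_denominator_pos[OF rational] det_killed_laplacian_pos[OF stochastic leads]
    by (simp add: prod_pos)
  ultimately have "1 \<le> ?D * det (killed_laplacian P Z)"
    using Ints_nonzero_abs_ge1 by fastforce
  then show ?thesis
    using det_killed_laplacian_pos[OF stochastic leads] by (simp add: divide_le_eq)
qed

section \<open>Hitting times and the Poisson equation\<close>

text \<open>The expectation is defined as the solution of its first-step equations, which are all that is
  needed of it.\<close>

definition expected_hitting_time :: "real^'n^'n \<Rightarrow> 'n set \<Rightarrow> real^'n" where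
  "expected_hitting_time P Z = green_matrix P Z *v (\<chi> i. if i \<in> Z then 0 else 1)"

lemma
  assumes "stochastic P" "leads_to P UNIV Z"
  shows expected_hitting_time_target: "i \<in> Z \<Longrightarrow> expected_hitting_time P Z $ i = 0"
    and expected_hitting_time_first_step:
      "i \<notin> Z \<Longrightarrow> expected_hitting_time P Z $ i = 1 + (P *v expected_hitting_time P Z) $ i"
  using killed_laplacian_mult[of P Z "expected_hitting_time P Z" i]
  unfolding expected_hitting_time_def killed_laplacian_mult_green_matrix[OF assms] by simp_all

lemma expected_hitting_time_le:
  fixes P :: "real^'n^'n"
  assumes stochastic: "stochastic P" and leads: "leads_to P UNIV Z"
    and rational: "\<And>i j. P $ i $ j \<in> \<rat>"
  shows "expected_hitting_time P Z $ i \<le> real CARD('n) * real (denominator_bound P)"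
proof -
  have "green_matrix P Z $ i $ j \<le> real (denominator_bound P)" for j
  proof -
    have "green_matrix P Z $ i $ j \<le> 1 / det (killed_laplacian P Z)"
      by (rule green_matrix_le_inverse_det[OF stochastic leads])
    also have "\<dots> \<le> real (\<Prod>i\<in>-Z. row_denominator P i)"
      by (rule inverse_det_killed_laplacian_le[OF stochastic leads rational])
    also have "\<dots> \<le> real (denominator_bound P)"
      using prod_row_denominator_le_denominator_bound[OF rational leads_to_imp_nonempty[OF leads]]
      by (rule of_nat_mono)
    finally show ?thesis .
  qed
  then have "expected_hitting_time P Z $ i \<le> (\<Sum>j\<in>(UNIV :: 'n set). real (denominator_bound P))"
    unfolding expected_hitting_time_def matrix_vector_mult_nth by (intro sum_mono) auto
  then show ?thesis by simp
qed

lemma poisson_inequality: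
  fixes P :: "real^'n^'n"
  assumes stochastic: "stochastic P" and closed: "closed_states P S" and leads: "leads_to P S Z"
    and defect: "\<And>k. k \<in> S - Z \<Longrightarrow> (x - P *v x) $ k \<le> c" and "i \<in> S"
  obtains z where "z \<in> S \<inter> Z" "x $ i \<le> c * expected_hitting_time P (Z \<union> - S) $ i + x $ z"
proof -
  let ?y = "expected_hitting_time P (Z \<union> - S)"
  note absorbing = leads_to_Un_Compl[OF leads]
  have "(x - c *\<^sub>R ?y) $ k \<le> (P *v (x - c *\<^sub>R ?y)) $ k" if "k \<in> S - Z" for k
    using that defect[OF that] expected_hitting_time_first_step[OF stochastic absorbing, of k]
    by (simp add: matrix_vector_mult_diff_distrib matrix_vector_mult_scaleR distrib_left)
  then obtain z where z: "z \<in> S \<inter> Z" "(x - c *\<^sub>R ?y) $ i \<le> (x - c *\<^sub>R ?y) $ z"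
    using maximum_principle[OF stochastic closed leads _ \<open>i \<in> S\<close>] by blast
  then show ?thesis
    using that[of z] expected_hitting_time_target[OF stochastic absorbing, of z] by simp
qed

lemma infnorm_le_iff_cart: "infnorm x \<le> c \<longleftrightarrow> (\<forall>i. \<bar>x $ i\<bar> \<le> c)"
  for x :: "real^'n"
proof
  assume "\<forall>i. \<bar>x $ i\<bar> \<le> c"
  then show "infnorm x \<le> c" unfolding infnorm_cart by (intro cSup_least) auto
qed (meson component_le_infnorm_cart order_trans)

lemma infnorm_defect_uminus: "infnorm (- x - P *v (- x)) = infnorm (x - P *v x)"
  for P :: "real^'n^'n"
  using infnorm_neg[of "x - P *v x"] by (simp add: vec.neg)

lemma defect_le_infnorm: "(x - P *v x) $ k \<le> infnorm (x - P *v x)"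
  for P :: "real^'n^'n"
  using component_le_infnorm_cart abs_le_D1 by blast

lemma le_hitting_time_plus_boundary_bound:
  assumes stochastic: "stochastic P" and leads: "leads_to P UNIV Z"
    and boundary: "\<And>z. z \<in> Z \<Longrightarrow> x $ z \<le> b"
  shows "x $ i \<le> infnorm (x - P *v x) * expected_hitting_time P Z $ i + b"
proof -
  obtain z where "z \<in> Z" "x $ i \<le> infnorm (x - P *v x) * expected_hitting_time P Z $ i + x $ z"
    using poisson_inequality[OF stochastic closed_states_UNIV leads defect_le_infnorm, of i]
    by auto
  then show ?thesis using boundary[of z] by linarith
qed

lemma abs_le_hitting_time_plus_boundary_bound:
  assumes stochastic: "stochastic P" and leads: "leads_to P UNIV Z"
    and boundary: "\<And>z. z \<in> Z \<Longrightarrow> \<bar>x $ z\<bar> \<le> b"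
  shows "\<bar>x $ i\<bar> \<le> infnorm (x - P *v x) * expected_hitting_time P Z $ i + b"
proof (rule abs_leI)
  show "x $ i \<le> infnorm (x - P *v x) * expected_hitting_time P Z $ i + b"
    by (rule le_hitting_time_plus_boundary_bound[OF stochastic leads abs_le_D1[OF boundary]])
  have "(- x) $ z \<le> b" if "z \<in> Z" for z using boundary[OF that] by simp
  from le_hitting_time_plus_boundary_bound[OF stochastic leads this]
  show "- x $ i \<le> infnorm (x - P *v x) * expected_hitting_time P Z $ i + b"
    by (simp add: infnorm_defect_uminus)
qed

lemma weighted_mean_le_max:
  fixes f w :: "'a \<Rightarrow> real"
  assumes "finite C" "\<And>i. i \<in> C \<Longrightarrow> 0 \<le> w i" "sum w C = 1"
  obtains i where "i \<in> C" "(\<Sum>j\<in>C. f j * w j) \<le> f i"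
proof -
  have "C \<noteq> {}" using assms(3) by auto
  then obtain i where i: "i \<in> C" "\<And>j. j \<in> C \<Longrightarrow> f j \<le> f i"
    using finite_attains_max[OF assms(1)] by blast
  have "(\<Sum>j\<in>C. f j * w j) \<le> (\<Sum>j\<in>C. f i * w j)"
    using assms(2) i(2) by (intro sum_mono mult_right_mono)
  also have "\<dots> = f i" using assms(3) by (simp flip: sum_distrib_left)
  finally show ?thesis using that i(1) by blast
qed

lemma stationary_distribution_on_sum:
  assumes "stationary_distribution_on P C d"
  shows "(\<Sum>i\<in>C. d $ i) = 1"
proof -
  have "(\<Sum>i\<in>C. d $ i) = (\<Sum>i\<in>UNIV. d $ i)"
    using assms unfolding stationary_distribution_on_def by (intro sum.mono_neutral_left) auto
  then show ?thesis using assms by (simp add: stationary_distribution_on_def)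
qed

lemma ge_minus_hitting_time_if_mean_zero:
  assumes stochastic: "stochastic P" and closed: "closed_states P C" and leads: "leads_to P C {z}"
    and distribution: "stationary_distribution_on P C d" and mean: "(\<Sum>i\<in>C. x $ i * d $ i) = 0"
  obtains i where "- (infnorm (x - P *v x) * expected_hitting_time P ({z} \<union> - C) $ i) \<le> x $ z"
proof -
  have "\<And>i. 0 \<le> d $ i" using distribution by (simp add: stationary_distribution_on_def)
  then obtain i where i: "i \<in> C" "0 \<le> x $ i"
    using weighted_mean_le_max[of C "($) d" "($) x"] mean
      stationary_distribution_on_sum[OF distribution] by auto
  obtain z' where "z' \<in> C \<inter> {z}"
      "x $ i \<le> infnorm (x - P *v x) * expected_hitting_time P ({z} \<union> - C) $ i + x $ z'"
    using poisson_inequality[OF stochastic closed leads defect_le_infnorm i(1)] .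
  then show ?thesis using that[of i] i(2) by simp
qed

section \<open>Bias vectors\<close>

text \<open>The set where \<open>g\<close> is maximal is closed under \<open>P\<close>; evaluate the equation for \<open>u\<close> at a
  maximum of \<open>u\<close> on that set.\<close>

lemma gain_le:
  fixes P :: "real^'n^'n"
  assumes stochastic: "stochastic P" and gain: "P *v g = g" and bias: "P *v u = g + u - r"
    and reward: "\<And>i. r $ i \<le> c"
  shows "g $ i \<le> c"
proof -
  obtain m where m: "\<And>l. g $ l \<le> g $ m" using finite_attains_max[of UNIV "($) g"] by auto
  define T where "T = {k. g $ k = g $ m}"
  have closed: "closed_states P T"
    unfolding closed_states_def
  proof (intro ballI allI impI)
    fix k l assume "k \<in> T" "0 < P $ k $ l"
    then show "l \<in> T"
      using stochastic_mean_eq_bound[OF stochastic, of k g "g $ m" l] m gain by (simp add: T_def)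
  qed
  obtain k where k: "k \<in> T" "\<And>l. l \<in> T \<Longrightarrow> u $ l \<le> u $ k"
    using finite_attains_max[of T "($) u"] by (auto simp: T_def)
  have "(P *v u) $ k \<le> u $ k"
    using stochastic_mean_le_bound[OF stochastic] closed_statesD[OF closed k(1)] k(2) by blast
  then have "g $ k \<le> c" using bias reward[of k] by simp
  then show ?thesis using m[of i] k(1) by (simp add: T_def)
qed

lemma infnorm_gain_le:
  fixes P :: "real^'n^'n"
  assumes stochastic: "stochastic P" and gain: "P *v g = g" and bias: "P *v u = g + u - r"
  shows "infnorm g \<le> infnorm r"
  unfolding infnorm_le_iff_cart
proof (intro allI abs_leI)
  have reward: "\<bar>r $ i\<bar> \<le> infnorm r" for i by (rule component_le_infnorm_cart)
  fix i
  show "g $ i \<le> infnorm r"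
    by (rule gain_le[OF stochastic gain bias abs_le_D1[OF reward]])
  have "(- g) $ i \<le> infnorm r"
  proof (rule gain_le[OF stochastic])
    show "P *v (- g) = - g" "P *v (- u) = - g + - u - - r"
      using gain bias by (simp_all add: vec.neg)
    show "(- r) $ i \<le> infnorm r" for i using reward[of i] by simp
  qed
  then show "- g $ i \<le> infnorm r" by simp
qed

lemma infnorm_bias_defect_le:
  fixes P :: "real^'n^'n"
  assumes "stochastic P" "bias_vector r P u"
  shows "infnorm (u - P *v u) \<le> 2 * infnorm r"
proof -
  obtain g where g: "P *v g = g" "P *v u = g + u - r"
    using assms(2) unfolding bias_vector_def by blast
  then have "infnorm (u - P *v u) = infnorm (r + - g)" by simp
  also have "\<dots> \<le> infnorm r + infnorm g"
    using infnorm_triangle[of r "- g"] by (simp add: infnorm_neg)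
  also have "\<dots> \<le> 2 * infnorm r" using infnorm_gain_le[OF assms(1) g] by simp
  finally show ?thesis .
qed

lemma bias_defect_hitting_time_le:
  fixes P :: "real^'n^'n"
  assumes stochastic: "stochastic P" and rational: "\<And>i j. P $ i $ j \<in> \<rat>"
    and bias: "bias_vector r P u" and leads: "leads_to P UNIV Z"
  shows "infnorm (u - P *v u) * expected_hitting_time P Z $ i
    \<le> 2 * infnorm r * real CARD('n) * real (denominator_bound P)"
proof -
  have "infnorm (u - P *v u) * expected_hitting_time P Z $ i
      \<le> infnorm (u - P *v u) * (real CARD('n) * real (denominator_bound P))"
    by (intro mult_left_mono expected_hitting_time_le stochastic leads rational infnorm_pos_le)
  also have "\<dots> \<le> 2 * infnorm r * (real CARD('n) * real (denominator_bound P))"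
    by (intro mult_right_mono infnorm_bias_defect_le[OF stochastic bias]) simp
  finally show ?thesis by (simp add: mult.assoc)
qed

lemma infnorm_bias_le_if_zero_in_recurrent_classes:
  fixes P :: "real^'n^'n"
  assumes stochastic: "stochastic P" and rational: "\<And>i j. P $ i $ j \<in> \<rat>"
    and bias: "bias_vector r P u" and zero: "\<And>C. C \<in> recurrent_classes P \<Longrightarrow> \<exists>i\<in>C. u $ i = 0"
  shows "infnorm u \<le> 2 * infnorm r * real CARD('n) * real (denominator_bound P)"
  unfolding infnorm_le_iff_cart
proof
  fix i
  have leads: "leads_to P UNIV {z. u $ z = 0}"
    using zero by (intro leads_to_if_meets_recurrent_classes[OF stochastic]) blast
  have "\<bar>u $ i\<bar> \<le> infnorm (u - P *v u) * expected_hitting_time P {z. u $ z = 0} $ i + 0"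
    by (rule abs_le_hitting_time_plus_boundary_bound[OF stochastic leads]) simp
  then show "\<bar>u $ i\<bar> \<le> 2 * infnorm r * real CARD('n) * real (denominator_bound P)"
    using bias_defect_hitting_time_le[OF stochastic rational bias leads, of i] by linarith
qed

lemma abs_bias_le_if_mean_zero:
  fixes P :: "real^'n^'n"
  assumes stochastic: "stochastic P" and rational: "\<And>i j. P $ i $ j \<in> \<rat>"
    and bias: "bias_vector r P u" and closed: "closed_states P C" and leads: "leads_to P C {z}"
    and distribution: "stationary_distribution_on P C d" and mean: "(\<Sum>i\<in>C. u $ i * d $ i) = 0"
  shows "\<bar>u $ z\<bar> \<le> 2 * infnorm r * real CARD('n) * real (denominator_bound P)" (is "_ \<le> ?B")
proof (rule abs_leI)
  note lower_bound = ge_minus_hitting_time_if_mean_zero[OF stochastic closed leads distribution]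
  note hitting_bound =
    bias_defect_hitting_time_le[OF stochastic rational bias leads_to_Un_Compl[OF leads]]
  have "(\<Sum>i\<in>C. (- u) $ i * d $ i) = 0" using mean by (simp add: sum_negf)
  then obtain i where
    "- (infnorm (u - P *v u) * expected_hitting_time P ({z} \<union> - C) $ i) \<le> (- u) $ z"
    using lower_bound[of "- u"] unfolding infnorm_defect_uminus by blast
  then show "u $ z \<le> ?B" using hitting_bound[of i] by simp
  obtain i where "- (infnorm (u - P *v u) * expected_hitting_time P ({z} \<union> - C) $ i) \<le> u $ z"
    using lower_bound[OF mean] .
  then show "- u $ z \<le> ?B" using hitting_bound[of i] by simp
qed

lemma infnorm_bias_le_if_mean_zero_on_recurrent_classes:
  fixes P :: "real^'n^'n"
  assumes stochastic: "stochastic P" and rational: "\<And>i j. P $ i $ j \<in> \<rat>"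
    and bias: "bias_vector r P u"
    and distribution: "\<And>C. C \<in> recurrent_classes P \<Longrightarrow> stationary_distribution_on P C (\<pi> C)"
    and mean: "\<And>C. C \<in> recurrent_classes P \<Longrightarrow> (\<Sum>i\<in>C. u $ i * \<pi> C $ i) = 0"
  shows "infnorm u \<le> 4 * infnorm r * real CARD('n) * real (denominator_bound P)"
  unfolding infnorm_le_iff_cart
proof
  fix i
  let ?B = "2 * infnorm r * real CARD('n) * real (denominator_bound P)"
    and ?E = "{z. essential_state P z}"
  have "\<bar>u $ z\<bar> \<le> ?B" if "z \<in> ?E" for z
  proof -
    have essential: "essential_state P z" using that by simp
    note recurrent = essential_class_recurrent[OF stochastic essential]
    show ?thesis
      by (rule abs_bias_le_if_mean_zero[OF stochastic rational bias
            closed_states_essential_class[OF essential]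
            communicating_class_leads_to[OF communicating_class_self]
            distribution[OF recurrent] mean[OF recurrent]])
  qed
  then have "\<bar>u $ i\<bar> \<le> infnorm (u - P *v u) * expected_hitting_time P ?E $ i + ?B"
    by (rule abs_le_hitting_time_plus_boundary_bound[OF stochastic leads_to_essential_states])
  also have "\<dots> \<le> ?B + ?B"
    by (intro add_right_mono
        bias_defect_hitting_time_le[OF stochastic rational bias leads_to_essential_states])
  finally show "\<bar>u $ i\<bar> \<le> 4 * infnorm r * real CARD('n) * real (denominator_bound P)" by simp
qed

theorem theorem1p5:
  fixes P :: "real^'n^'n" and r u :: "real^'n" and \<pi> :: "'n set \<Rightarrow> real^'n"
  assumes "stochastic P"
    and "\<forall>i j. P $ i $ j \<in> \<rat>"
    and "\<forall>i. r $ i \<in> \<int>"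
    and "bias_vector r P u"
    and "\<forall>C\<in>recurrent_classes P. stationary_distribution_on P C (\<pi> C)"
  shows "((\<forall>C\<in>recurrent_classes P. \<exists>i\<in>C. u $ i = 0) \<longrightarrow>
           infnorm u \<le> 2 * infnorm r * real CARD('n) *
             real (min (\<Prod>i\<in>UNIV. row_denominator P i)
                       (matrix_denominator P ^ (CARD('n) - 1))))
       \<and> ((\<forall>C\<in>recurrent_classes P. (\<Sum>i\<in>C. u $ i * \<pi> C $ i) = 0) \<longrightarrow>
           infnorm u \<le> 4 * infnorm r * real CARD('n) *
             real (min (\<Prod>i\<in>UNIV. row_denominator P i)
                       (matrix_denominator P ^ (CARD('n) - 1))))"
  unfolding denominator_bound_def[symmetric]
proof (intro conjI impI)
  have rational: "P $ i $ j \<in> \<rat>" for i j using assms(2) by simp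
  show "infnorm u \<le> 2 * infnorm r * real CARD('n) * real (denominator_bound P)"
    if "\<forall>C\<in>recurrent_classes P. \<exists>i\<in>C. u $ i = 0"
    using that
    by (intro infnorm_bias_le_if_zero_in_recurrent_classes[OF assms(1) rational assms(4)]) blast
  show "infnorm u \<le> 4 * infnorm r * real CARD('n) * real (denominator_bound P)"
    if "\<forall>C\<in>recurrent_classes P. (\<Sum>i\<in>C. u $ i * \<pi> C $ i) = 0"
    using that assms(5)
    by (intro infnorm_bias_le_if_mean_zero_on_recurrent_classes[OF assms(1) rational assms(4)])
      blast+
qed

end
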